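(* Let $\pi\colon (X,T)\to (Y,S)$ be an intrinsic factor map between dynamical systems and $\mathscr{F}$ be a Furstenberg family. If $\pi$ is $\mathscr{F}$-point mixing of all finite orders, then the collection of $\mathscr{F}$-mixing sets is residual in $H_\pi$. Furthermore, if $\pi$ is open, then there is a dense $G_\delta$ subset $Y_0$ of $Y$ such that $\pi^{-1}(y)$ is an $\mathscr{F}$-mixing set for every $y\in Y_0$.
   Context: A dynamical system is a pair $(X,T)$, where $X$ is a non-empty compact metric space and $T$ is a homeomorphism from $X$ to itself. $\mathbb{N}$ is the set of positive integers. A Furstenberg family is a collection $\mathscr{F}$ of subsets of $\mathbb{N}$ that is hereditary upward ($F_1\subset F_2$ and $F_1\in\mathscr{F}$ imply $F_2\in\mathscr{F}$); all families are assumed proper (neither empty nor the collection of all subsets of $\mathbb{N}$) and contained in the family of all infinite subsets of $\mathbb{N}$. For $U,V\subset X$ and $x\in X$, $N(U,V)=\{n\in\mathbb{N}\colon U\cap T^{-n}(V)\neq\emptyset\}$ and $N(x,U)=\{n\in\mathbb{N}\colon T^n(x)\in U\}$. A closed subset $A$ of $X$ with at least two points is $\mathscr{F}$-mixing if for any $k\in\mathbb{N}$ and any open subsets $U_1,\dots,U_k,V_1,\dots,V_k$ of $X$ each intersecting $A$, $\bigcap_{i=1}^k N(U_i\cap A,V_i)\in\mathscr{F}$. A point $x$ of a system $(X,T)$ is an $\mathscr{F}$-transitive point if $N(x,U)\in\mathscr{F}$ for every non-empty open $U\subset X$; the set of these is $\operatorname{Trans}_{\mathscr{F}}(X,T)$.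 A factor map $\pi\colon(X,T)\to(Y,S)$ is a continuous surjection $\pi\colon X\to Y$ with $\pi\circ T=S\circ\pi$; it is intrinsic if $\pi$ is not a homeomorphism, and open if it maps open sets to open sets. For $n\geq2$, $R_\pi^{(n)}=\{(x_1,\dots,x_n)\in X^n\colon \pi(x_1)=\dotsb=\pi(x_n)\}$ and $T^{(n)}=T\times\dotsb\times T$ ($n$ times). $\pi$ is $\mathscr{F}$-point mixing of all finite orders if $\operatorname{Trans}_{\mathscr{F}}(R_\pi^{(n)},T^{(n)})$ is a dense $G_\delta$ subset of $R_\pi^{(n)}$ for every $n\geq2$. $2^X$ is the hyperspace of all non-empty closed subsets of $X$ with the Hausdorff metric, and the fiber space is $H_\pi=\bigcup_{y\in Y}2^{\pi^{-1}(y)}\subset2^X$ (non-empty closed sets contained in a single fiber of $\pi$). A collection of closed sets is residual in $H_\pi$ if its intersection with $H_\pi$ contains a dense $G_\delta$ subset of $H_\pi$. *)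

theory Defs
  imports "HOL-Analysis.Analysis"
begin

text \<open>
  A compact metric space is a compact set \<open>X\<close> in a type of class \<open>metric_space\<close>, carrying the
  topology \<open>top_of_set X\<close>. Maps are total functions of which only the values on the carrier matter.
\<close>

definition dynamical_system :: "'a::metric_space set \<Rightarrow> ('a \<Rightarrow> 'a) \<Rightarrow> bool" where
  "dynamical_system X T \<longleftrightarrow>
     X \<noteq> {} \<and> compact X \<and> homeomorphic_map (top_of_set X) (top_of_set X) T"

text \<open>The two standing assumptions, properness and containment in the family of infinite sets,
  are part of the definition; the set of positive integers is \<open>{1..}\<close>.\<close>

definition furstenberg_family :: "nat set set \<Rightarrow> bool" where
  "furstenberg_family F \<longleftrightarrow>
     F \<subseteq> Pow {1..} \<and>
     (\<forall>A B. A \<in> F \<and> A \<subseteq> B \<and> B \<subseteq> {1..} \<longrightarrow> B \<in> F) \<and>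
     F \<noteq> {} \<and> F \<noteq> Pow {1..} \<and>
     (\<forall>A\<in>F. infinite A)"

definition hitting_times :: "('a \<Rightarrow> 'a) \<Rightarrow> 'a set \<Rightarrow> 'a set \<Rightarrow> nat set" where
  "hitting_times T U V = {n. 1 \<le> n \<and> U \<inter> (T ^^ n) -` V \<noteq> {}}"

definition entering_times :: "('a \<Rightarrow> 'a) \<Rightarrow> 'a \<Rightarrow> 'a set \<Rightarrow> nat set" where
  "entering_times T x U = {n. 1 \<le> n \<and> (T ^^ n) x \<in> U}"

definition mixing_set ::
    "nat set set \<Rightarrow> 'a::metric_space set \<Rightarrow> ('a \<Rightarrow> 'a) \<Rightarrow> 'a set \<Rightarrow> bool" where
  "mixing_set F X T A \<longleftrightarrow>
     closedin (top_of_set X) A \<and> (\<exists>x\<in>A. \<exists>y\<in>A. x \<noteq> y) \<and>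
     (\<forall>k\<ge>1. \<forall>U V :: nat \<Rightarrow> 'a set.
        (\<forall>i\<in>{1..k}. openin (top_of_set X) (U i) \<and> U i \<inter> A \<noteq> {} \<and>
                     openin (top_of_set X) (V i) \<and> V i \<inter> A \<noteq> {}) \<longrightarrow>
        (\<Inter>i\<in>{1..k}. hitting_times T (U i \<inter> A) (V i)) \<in> F)"

text \<open>Stated for an abstract topology, so that it applies to spaces of tuples as well.\<close>

definition transitive_points :: "nat set set \<Rightarrow> 'a topology \<Rightarrow> ('a \<Rightarrow> 'a) \<Rightarrow> 'a set" where
  "transitive_points F \<tau> T =
     {x \<in> topspace \<tau>. \<forall>U. openin \<tau> U \<and> U \<noteq> {} \<longrightarrow> entering_times T x U \<in> F}"

definition dense_gdelta_in :: "'a topology \<Rightarrow> 'a set \<Rightarrow> bool" where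
  "dense_gdelta_in \<tau> G \<longleftrightarrow> gdelta_in \<tau> G \<and> \<tau> closure_of G = topspace \<tau>"

definition residual_in :: "'a topology \<Rightarrow> 'a set \<Rightarrow> bool" where
  "residual_in \<tau> C \<longleftrightarrow> (\<exists>G. dense_gdelta_in \<tau> G \<and> G \<subseteq> C \<inter> topspace \<tau>)"

definition factor_map ::
    "'a::metric_space set \<Rightarrow> ('a \<Rightarrow> 'a) \<Rightarrow> 'b::metric_space set \<Rightarrow> ('b \<Rightarrow> 'b) \<Rightarrow> ('a \<Rightarrow> 'b) \<Rightarrow> bool"
  where
  "factor_map X T Y S p \<longleftrightarrow>
     continuous_map (top_of_set X) (top_of_set Y) p \<and> p ` X = Y \<and> (\<forall>x\<in>X. p (T x) = S (p x))"

definition intrinsic_factor_map ::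
    "'a::metric_space set \<Rightarrow> ('a \<Rightarrow> 'a) \<Rightarrow> 'b::metric_space set \<Rightarrow> ('b \<Rightarrow> 'b) \<Rightarrow> ('a \<Rightarrow> 'b) \<Rightarrow> bool"
  where
  "intrinsic_factor_map X T Y S p \<longleftrightarrow>
     factor_map X T Y S p \<and> \<not> homeomorphic_map (top_of_set X) (top_of_set Y) p"

definition fiber :: "'a set \<Rightarrow> ('a \<Rightarrow> 'b) \<Rightarrow> 'b \<Rightarrow> 'a set" where
  "fiber X p y = {x \<in> X. p x = y}"

text \<open>An \<open>n\<close>-tuple in \<open>X\<close> is an extensional function on \<open>{1..n}\<close>, as required by
  \<open>product_topology\<close>.\<close>

definition fiber_tuples :: "'a set \<Rightarrow> ('a \<Rightarrow> 'b) \<Rightarrow> nat \<Rightarrow> (nat \<Rightarrow> 'a) set" where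
  "fiber_tuples X p n =
     {x \<in> {1..n} \<rightarrow>\<^sub>E X. \<forall>i\<in>{1..n}. \<forall>j\<in>{1..n}. p (x i) = p (x j)}"

definition fiber_tuples_topology ::
    "'a::metric_space set \<Rightarrow> ('a \<Rightarrow> 'b) \<Rightarrow> nat \<Rightarrow> (nat \<Rightarrow> 'a) topology" where
  "fiber_tuples_topology X p n =
     subtopology (product_topology (\<lambda>_. top_of_set X) {1..n}) (fiber_tuples X p n)"

definition diagonal_map :: "nat \<Rightarrow> ('a \<Rightarrow> 'a) \<Rightarrow> (nat \<Rightarrow> 'a) \<Rightarrow> (nat \<Rightarrow> 'a)" where
  "diagonal_map n T x = (\<lambda>i\<in>{1..n}. T (x i))"

definition point_mixing_all_orders ::
    "nat set set \<Rightarrow> 'a::metric_space set \<Rightarrow> ('a \<Rightarrow> 'a) \<Rightarrow> ('a \<Rightarrow> 'b) \<Rightarrow> bool" where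
  "point_mixing_all_orders F X T p \<longleftrightarrow>
     (\<forall>n\<ge>2. dense_gdelta_in (fiber_tuples_topology X p n)
               (transitive_points F (fiber_tuples_topology X p n) (diagonal_map n T)))"

definition hyperspace :: "'a::metric_space set \<Rightarrow> 'a set set" where
  "hyperspace X = {A. A \<noteq> {} \<and> closedin (top_of_set X) A}"

text \<open>The value \<open>0\<close> off the non-empty bounded sets is a dummy: the locale \<open>Metric_space\<close> demands
  non-negativity also outside the carrier.\<close>

definition hausdorff_dist :: "'a::metric_space set \<Rightarrow> 'a set \<Rightarrow> real" where
  "hausdorff_dist A B =
     (if A \<noteq> {} \<and> B \<noteq> {} \<and> bounded A \<and> bounded B
      then max (SUP a\<in>A. infdist a B) (SUP b\<in>B. infdist b A) else 0)"

definition fiber_space :: "'a::metric_space set \<Rightarrow> 'b set \<Rightarrow> ('a \<Rightarrow> 'b) \<Rightarrow> 'a set set" where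
  "fiber_space X Y p = (\<Union>y\<in>Y. hyperspace (fiber X p y))"

definition fiber_space_topology ::
    "'a::metric_space set \<Rightarrow> 'b set \<Rightarrow> ('a \<Rightarrow> 'b) \<Rightarrow> 'a set topology" where
  "fiber_space_topology X Y p =
     subtopology (Metric_space.mtopology (hyperspace X) hausdorff_dist) (fiber_space X Y p)"

text \<open>\<open>Metric_space.mtopology\<close> is meaningful only for an actual metric.\<close>

lemma bdd_above_infdist:
  assumes "bounded A"
  shows "bdd_above ((\<lambda>a. infdist a B) ` A)"
proof (cases "A = {}")
  case False
  then obtain c where "c \<in> A" by blast
  with assms obtain e where e: "\<And>a. a \<in> A \<Longrightarrow> dist c a \<le> e"
    using bounded_any_center by metis
  have "infdist a B \<le> infdist c B + e" if "a \<in> A" for a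
    using infdist_triangle[of a B c] e[OF that] by (simp add: dist_commute)
  then show ?thesis by (auto intro!: bdd_aboveI2)
qed simp

lemma hyperspaceD:
  assumes "compact X" "A \<in> hyperspace X"
  shows "A \<noteq> {}" "compact A" "bounded A" "closed A"
  using assms closedin_compact[of X A]
  by (auto simp: hyperspace_def compact_imp_bounded compact_imp_closed)

lemma infdist_le_hausdorff_dist:
  assumes "compact X" "A \<in> hyperspace X" "B \<in> hyperspace X" "a \<in> A"
  shows "infdist a B \<le> hausdorff_dist A B"
proof -
  have "infdist a B \<le> (SUP a\<in>A. infdist a B)"
    using assms hyperspaceD by (intro cSUP_upper bdd_above_infdist) auto
  then show ?thesis
    using hyperspaceD[OF assms(1,2)] hyperspaceD[OF assms(1,3)] by (simp add: hausdorff_dist_def)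
qed

lemma hausdorff_dist_commute: "hausdorff_dist A B = hausdorff_dist B A"
  by (auto simp: hausdorff_dist_def max.commute)

lemma hausdorff_dist_nonneg: "0 \<le> hausdorff_dist A B"
proof (cases "A \<noteq> {} \<and> B \<noteq> {} \<and> bounded A \<and> bounded B")
  case True
  then obtain a where a: "a \<in> A" by blast
  have "0 \<le> (SUP a\<in>A. infdist a B)"
    using True by (intro cSUP_upper2[OF _ a infdist_nonneg] bdd_above_infdist) auto
  with True show ?thesis by (simp add: hausdorff_dist_def le_max_iff_disj)
qed (auto simp: hausdorff_dist_def)

lemma infdist_triangle_hausdorff:
  assumes "compact X" "A \<in> hyperspace X" "B \<in> hyperspace X" "C \<in> hyperspace X" "a \<in> A"
  shows "infdist a C \<le> hausdorff_dist A B + hausdorff_dist B C"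
proof -
  note B = hyperspaceD[OF assms(1,3)]
  have "continuous_on B (dist a)"
    by (intro continuous_intros)
  then obtain b where b: "b \<in> B" "\<And>b'. b' \<in> B \<Longrightarrow> dist a b \<le> dist a b'"
    using continuous_attains_inf[OF B(2,1)] by blast
  have "dist a b \<le> infdist a B"
    using b B(1) by (auto simp: infdist_notempty intro: cINF_greatest)
  moreover have "infdist a B \<le> hausdorff_dist A B" "infdist b C \<le> hausdorff_dist B C"
    using assms b infdist_le_hausdorff_dist by blast+
  moreover have "infdist a C \<le> infdist b C + dist a b"
    by (rule infdist_triangle)
  ultimately show ?thesis by linarith
qed

lemma Metric_space_hyperspace:
  assumes X: "compact X"
  shows "Metric_space (hyperspace X) hausdorff_dist"
proof
  show "0 \<le> hausdorff_dist A B" for A B :: "'a set"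
    by (rule hausdorff_dist_nonneg)
  show "hausdorff_dist A B = hausdorff_dist B A" for A B :: "'a set"
    by (rule hausdorff_dist_commute)
next
  fix A B assume AB: "A \<in> hyperspace X" "B \<in> hyperspace X"
  show "hausdorff_dist A B = 0 \<longleftrightarrow> A = B"
  proof
    have sub: "A \<subseteq> B" if "hausdorff_dist A B = 0" "A \<in> hyperspace X" "B \<in> hyperspace X" for A B
    proof
      fix a assume "a \<in> A"
      then have "infdist a B = 0"
        using infdist_le_hausdorff_dist[OF X that(2,3)] that(1) infdist_nonneg[of a B]
        by fastforce
      then show "a \<in> B"
        using hyperspaceD[OF X that(3)] by (simp add: in_closed_iff_infdist_zero)
    qed
    show "A = B" if "hausdorff_dist A B = 0"
      using sub[of A B] sub[of B A] that AB hausdorff_dist_commute[of A B] by auto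
    show "hausdorff_dist A B = 0" if "A = B"
      using that hyperspaceD[OF X AB(1)] by (simp add: hausdorff_dist_def)
  qed
next
  fix A B C assume A: "A \<in> hyperspace X" and B: "B \<in> hyperspace X" and C: "C \<in> hyperspace X"
  have "(SUP a\<in>A. infdist a C) \<le> hausdorff_dist A B + hausdorff_dist B C"
    using infdist_triangle_hausdorff[OF X A B C] hyperspaceD[OF X A] by (intro cSUP_least) auto
  moreover have "(SUP c\<in>C. infdist c A) \<le> hausdorff_dist A B + hausdorff_dist B C"
    using infdist_triangle_hausdorff[OF X C B A] hyperspaceD[OF X C]
    by (intro cSUP_least) (auto simp: hausdorff_dist_commute add.commute)
  ultimately show "hausdorff_dist A C \<le> hausdorff_dist A B + hausdorff_dist B C"
    using hyperspaceD[OF X A] hyperspaceD[OF X C] by (simp add: hausdorff_dist_def[of A C])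
qed

lemma fiber_space_subset_hyperspace:
  fixes Y :: "'b::metric_space set"
  assumes "continuous_map (top_of_set X) (top_of_set Y) p"
  shows "fiber_space X Y p \<subseteq> hyperspace X"
proof -
  have "closedin (top_of_set X) (fiber X p y)" if "y \<in> Y" for y
    using closedin_continuous_map_preimage[OF assms, of "{y}"] that
    by (simp add: fiber_def closed_subset)
  then show ?thesis
    by (auto simp: fiber_space_def hyperspace_def intro: closedin_trans)
qed

lemma topspace_fiber_space_topology:
  fixes Y :: "'b::metric_space set"
  assumes "compact X" "continuous_map (top_of_set X) (top_of_set Y) p"
  shows "topspace (fiber_space_topology X Y p) = fiber_space X Y p"
  using fiber_space_subset_hyperspace[OF assms(2)]
  by (auto simp: fiber_space_topology_def
      Metric_space.topspace_mtopology[OF Metric_space_hyperspace[OF assms(1)]])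

end

theory Submission
  imports Defs
begin

text \<open>
  A closed set \<open>A\<close> in a fiber is mixing as soon as the transitive \<open>n\<close>-tuples are dense in the power
  \<open>A\<^sup>n\<close> for every \<open>n\<close> (\<open>mixing_set_if_transitive_tuples_dense\<close>): a transitive tuple with entries in
  the prescribed sets \<open>U i\<close> enters, at times that form a member of \<open>F\<close>, the box of the prescribed
  sets \<open>V i\<close>, and this box contains tuples since all of \<open>A\<close> lies over one point. Two distinct points
  are found in \<open>A\<close> because \<open>p\<close>, not being a homeomorphism between compact spaces, is not injective,
  so that transitive pairs are off the diagonal.

  It remains to see that this density is generic, both for \<open>A\<close> in the fiber space and, when \<open>p\<close> is
  open, for \<open>A\<close> the full fiber over \<open>y\<close>. Both cases follow from one Baire category argument
  (\<open>residual_mixing_fibers\<close>) over a parameter space \<open>Z\<close>, namely \<open>Z = H\<^sub>p\<close> or \<open>Z = Y\<close>. It has two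
  inputs. The first is lower semicontinuity: meeting an open set is an open condition on \<open>A\<close>, by the
  definition of the Hausdorff metric, respectively by the openness of \<open>p\<close>. The second is that \<open>A\<close>
  can be perturbed so that transitive tuples appear in given open sets that meet \<open>A\<close>. Over \<open>Y\<close> this
  is the density of transitive tuples. Over \<open>H\<^sub>p\<close> one replaces \<open>A\<close> by the entries of one long
  transitive tuple close to a finite net of \<open>A\<close>, whose initial segments are transitive too
  (\<open>transitive_points_restrict\<close>, \<open>fiber_space_dense_transitive_sets\<close>). The Baire property of
  \<open>H\<^sub>p\<close> comes from completeness of the Hausdorff metric (\<open>mcomplete_fiber_space\<close>).
\<close>

section \<open>Tuples in a fiber\<close>

text \<open>
  A basic open subset of the space of tuples. The factors \<open>U i\<close> are open in the ambient type and
  not only in \<open>X\<close>, so that balls can be used directly.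
\<close>

definition fiber_box :: "'a set \<Rightarrow> ('a \<Rightarrow> 'b) \<Rightarrow> nat \<Rightarrow> (nat \<Rightarrow> 'a set) \<Rightarrow> (nat \<Rightarrow> 'a) set" where
  "fiber_box X p n U = {x \<in> fiber_tuples X p n. \<forall>i\<in>{1..n}. x i \<in> U i}"

lemma topspace_fiber_tuples_topology:
  "topspace (fiber_tuples_topology X p n) = fiber_tuples X p n"
  by (auto simp: fiber_tuples_topology_def fiber_tuples_def)

lemma openin_fiber_box:
  assumes "\<And>i. i \<in> {1..n} \<Longrightarrow> open (U i)"
  shows "openin (fiber_tuples_topology X p n) (fiber_box X p n U)"
proof -
  have "openin (product_topology (\<lambda>_. top_of_set X) {1..n}) (PiE {1..n} (\<lambda>i. X \<inter> U i))"
    using assms by (subst openin_PiE) (auto simp: openin_open_Int)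
  moreover have "fiber_box X p n U = PiE {1..n} (\<lambda>i. X \<inter> U i) \<inter> fiber_tuples X p n"
    by (rule set_eqI) (simp only: fiber_box_def fiber_tuples_def PiE_iff Int_iff mem_Collect_eq, blast)
  ultimately show ?thesis
    unfolding fiber_tuples_topology_def openin_subtopology by blast
qed

lemma product_topology_box_neighbourhood:
  assumes "openin (product_topology \<tau> I) V" "v \<in> V"
  obtains B where "v \<in> PiE I B" "PiE I B \<subseteq> V" "\<And>i. i \<in> I \<Longrightarrow> openin (\<tau> i) (B i)"
  using assms unfolding openin_product_topology_alt by metis

lemma fiber_box_neighbourhood:
  assumes "openin (fiber_tuples_topology X p n) W" "a \<in> W"
  obtains U where "\<And>i. i \<in> {1..n} \<Longrightarrow> open (U i) \<and> a i \<in> U i" "fiber_box X p n U \<subseteq> W"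
proof -
  obtain V where V: "openin (product_topology (\<lambda>_. top_of_set X) {1..n}) V"
    "W = V \<inter> fiber_tuples X p n"
    using assms(1) unfolding fiber_tuples_topology_def openin_subtopology by blast
  then obtain B where B: "a \<in> PiE {1..n} B" "PiE {1..n} B \<subseteq> V"
    "\<And>i. i \<in> {1..n} \<Longrightarrow> openin (top_of_set X) (B i)"
    using assms(2) product_topology_box_neighbourhood[OF V(1)] by blast
  have "\<forall>i\<in>{1..n}. \<exists>G. open G \<and> B i = X \<inter> G"
    using B(3) by (auto simp: openin_open)
  then obtain U where U: "\<And>i. i \<in> {1..n} \<Longrightarrow> open (U i) \<and> B i = X \<inter> U i"
    by metis
  show ?thesis
  proof (rule that[of U])
    show "open (U i) \<and> a i \<in> U i" if "i \<in> {1..n}" for i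
      using U[OF that] B(1) that by (auto simp: PiE_iff)
    have "fiber_box X p n U \<subseteq> PiE {1..n} B"
    proof
      fix x assume "x \<in> fiber_box X p n U"
      then show "x \<in> PiE {1..n} B"
        using U unfolding fiber_box_def fiber_tuples_def PiE_iff by simp
    qed
    then show "fiber_box X p n U \<subseteq> W"
      using B(2) V(2) by (auto simp: fiber_box_def)
  qed
qed

lemma diagonal_map_funpow:
  assumes "x \<in> extensional {1..n}"
  shows "(diagonal_map n T ^^ k) x = (\<lambda>i\<in>{1..n}. (T ^^ k) (x i))"
proof (induction k)
  case 0
  then show ?case using assms by (simp add: extensional_restrict)
next
  case (Suc k)
  then show ?case by (auto simp: diagonal_map_def fun_eq_iff)
qed

lemma fiber_tuples_extensional: "x \<in> fiber_tuples X p n \<Longrightarrow> x \<in> extensional {1..n}"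
  by (auto simp: fiber_tuples_def PiE_iff)

lemma furstenberg_family_mono:
  assumes "furstenberg_family F" "A \<in> F" "A \<subseteq> B" "B \<subseteq> {1..}"
  shows "B \<in> F"
  using assms unfolding furstenberg_family_def by blast

text \<open>
  Dropping coordinates sends the longer tuples \<^emph>\<open>onto\<close> the shorter ones, since a short tuple can be
  prolonged by repeating its first entry. Hence the preimage of a non-empty open set is non-empty
  and open, and the set of times at which the long tuple enters it is a member of \<open>F\<close>.
\<close>

lemma transitive_points_restrict:
  assumes F: "furstenberg_family F" and n: "1 \<le> n" "n \<le> N"
    and x: "x \<in> transitive_points F (fiber_tuples_topology X p N) (diagonal_map N T)"
  shows "restrict x {1..n} \<in> transitive_points F (fiber_tuples_topology X p n) (diagonal_map n T)"
proof -
  have sub: "{1..n} \<subseteq> {1..N}"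
    using n by auto
  have restr: "restrict y {1..n} \<in> fiber_tuples X p n" if "y \<in> fiber_tuples X p N" for y
    using that sub by (auto simp: fiber_tuples_def PiE_iff)
  have xR: "x \<in> fiber_tuples X p N"
    using x by (simp add: transitive_points_def topspace_fiber_tuples_topology)
  have "entering_times (diagonal_map n T) (restrict x {1..n}) W \<in> F"
    if W: "openin (fiber_tuples_topology X p n) W" "W \<noteq> {}" for W
  proof -
    define V where "V = {y \<in> fiber_tuples X p N. restrict y {1..n} \<in> W}"
    have "openin (fiber_tuples_topology X p N) V"
    proof (subst openin_subopen, intro ballI)
      fix y assume y: "y \<in> V"
      then obtain U where U: "\<And>i. i \<in> {1..n} \<Longrightarrow> open (U i) \<and> restrict y {1..n} i \<in> U i"
        "fiber_box X p n U \<subseteq> W"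
        using fiber_box_neighbourhood[OF W(1)] unfolding V_def by blast
      define U' where "U' i = (if i \<in> {1..n} then U i else UNIV)" for i
      have "openin (fiber_tuples_topology X p N) (fiber_box X p N U')"
        using U(1) by (intro openin_fiber_box) (auto simp: U'_def)
      moreover have "y \<in> fiber_box X p N U'"
        using y U(1) by (auto simp: fiber_box_def V_def U'_def)
      moreover have "fiber_box X p N U' \<subseteq> V"
      proof
        fix z assume z: "z \<in> fiber_box X p N U'"
        then have "z i \<in> U i" if "i \<in> {1..n}" for i
          using that sub unfolding fiber_box_def U'_def by fastforce
        then have "restrict z {1..n} \<in> fiber_box X p n U"
          using z restr[of z] by (simp add: fiber_box_def)
        then show "z \<in> V"
          using z U(2) by (auto simp: V_def fiber_box_def)
      qed
      ultimately show "\<exists>G. openin (fiber_tuples_topology X p N) G \<and> y \<in> G \<and> G \<subseteq> V"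
        by blast
    qed
    moreover have "V \<noteq> {}"
    proof -
      obtain w where w: "w \<in> W" using W(2) by blast
      then have wR: "w \<in> fiber_tuples X p n"
        using openin_subset[OF W(1)] by (auto simp: topspace_fiber_tuples_topology)
      define y where "y = (\<lambda>i\<in>{1..N}. if i \<in> {1..n} then w i else w 1)"
      have "restrict y {1..n} = w"
        using fiber_tuples_extensional[OF wR] sub by (auto simp: y_def extensional_def fun_eq_iff)
      moreover have "y \<in> fiber_tuples X p N"
        using wR n unfolding fiber_tuples_def y_def by (auto simp: PiE_iff)
      ultimately show ?thesis using w by (auto simp: V_def)
    qed
    ultimately have "entering_times (diagonal_map N T) x V \<in> F"
      using x by (simp add: transitive_points_def)
    moreover have "entering_times (diagonal_map N T) x V \<subseteq>
        entering_times (diagonal_map n T) (restrict x {1..n}) W"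
    proof -
      have "restrict ((diagonal_map N T ^^ k) x) {1..n} = (diagonal_map n T ^^ k) (restrict x {1..n})" for k
        unfolding diagonal_map_funpow[OF fiber_tuples_extensional[OF xR]]
          diagonal_map_funpow[OF restrict_extensional] using n by (auto simp: fun_eq_iff)
      then show ?thesis
        by (auto simp: entering_times_def V_def)
    qed
    ultimately show ?thesis
      by (rule furstenberg_family_mono[OF F]) (auto simp: entering_times_def)
  qed
  then show ?thesis
    using restr[OF xR] by (simp add: transitive_points_def topspace_fiber_tuples_topology)
qed

lemma intrinsic_factor_map_not_inj:
  assumes "compact X" "intrinsic_factor_map X T Y S p"
  obtains u v where "u \<in> X" "v \<in> X" "u \<noteq> v" "p u = p v"
proof -
  have p: "continuous_map (top_of_set X) (top_of_set Y) p" "p ` X = Y"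
    "\<not> homeomorphic_map (top_of_set X) (top_of_set Y) p"
    using assms(2) by (auto simp: intrinsic_factor_map_def factor_map_def)
  have "\<not> inj_on p X"
  proof
    assume "inj_on p X"
    then have "homeomorphic_map (top_of_set X) (top_of_set Y) p"
      using p assms(1)
      by (intro continuous_imp_homeomorphic_map)
         (auto simp: compact_space_subtopology Hausdorff_space_subtopology)
    then show False using p(3) by blast
  qed
  then show ?thesis using that by (auto simp: inj_on_def)
qed

text \<open>
  The off-diagonal pairs form a non-empty open set because \<open>p\<close> identifies two points. The orbit of a
  transitive pair visits it, which is impossible for an orbit that starts on the diagonal.
\<close>

lemma transitive_pair_distinct:
  fixes X :: "'a::metric_space set"
  assumes F: "furstenberg_family F" and uv: "u \<in> X" "v \<in> X" "u \<noteq> v" "p u = p v"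
    and x: "x \<in> transitive_points F (fiber_tuples_topology X p 2) (diagonal_map 2 T)"
  shows "x 1 \<noteq> x 2"
proof -
  have xR: "x \<in> fiber_tuples X p 2"
    using x by (simp add: transitive_points_def topspace_fiber_tuples_topology)
  obtain U V where UV: "open U" "open V" "u \<in> U" "v \<in> V" "U \<inter> V = {}"
    using uv(3) separation_t2 by metis
  let ?B = "fiber_box X p 2 (\<lambda>i. if i = 1 then U else V)"
  have "openin (fiber_tuples_topology X p 2) ?B"
    using UV by (intro openin_fiber_box) auto
  moreover have "(\<lambda>i\<in>{1..2}. if i = 1 then u else v) \<in> ?B"
    using UV uv by (auto simp: fiber_box_def fiber_tuples_def PiE_iff)
  ultimately have "entering_times (diagonal_map 2 T) x ?B \<in> F"
    using x by (auto simp: transitive_points_def)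
  then have "entering_times (diagonal_map 2 T) x ?B \<noteq> {}"
    using F by (auto simp: furstenberg_family_def)
  then obtain k where "(diagonal_map 2 T ^^ k) x \<in> ?B"
    by (auto simp: entering_times_def)
  then have "(\<lambda>i\<in>{1..2}. (T ^^ k) (x i)) \<in> ?B"
    by (simp add: diagonal_map_funpow[OF fiber_tuples_extensional[OF xR]])
  then have "\<forall>i\<in>{1..2}. (T ^^ k) (x i) \<in> (if i = 1 then U else V)"
    by (simp add: fiber_box_def)
  from bspec[OF this, of 1] bspec[OF this, of 2]
  have "(T ^^ k) (x 1) \<in> U" "(T ^^ k) (x 2) \<in> V"
    by simp_all
  then show ?thesis using UV(5) by auto
qed

section \<open>From transitive tuples to mixing\<close>

text \<open>
  Pick a transitive tuple \<open>a\<close> with \<open>a i\<close> in \<open>U i \<inter> A\<close>. Points of \<open>A\<close> chosen in the sets \<open>V i\<close> form a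
  tuple in a single fiber, so the box of the sets \<open>V i\<close> is a non-empty open set of tuples. The times
  at which \<open>a\<close> enters this box form a member of \<open>F\<close>, and they are simultaneous hitting times.
\<close>

lemma mixing_set_if_transitive_tuples_dense:
  fixes X :: "'a::metric_space set"
  assumes F: "furstenberg_family F" and uv: "u \<in> X" "v \<in> X" "u \<noteq> v" "p u = p v"
    and A: "closedin (top_of_set X) A" "A \<noteq> {}" "A \<subseteq> fiber X p y"
    and dense: "\<And>n U. \<lbrakk>n \<ge> 2; \<And>i. i \<in> {1..n} \<Longrightarrow> open (U i) \<and> U i \<inter> A \<noteq> {}\<rbrakk> \<Longrightarrow>
      transitive_points F (fiber_tuples_topology X p n) (diagonal_map n T)
        \<inter> PiE {1..n} (\<lambda>i. U i \<inter> A) \<noteq> {}"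
  shows "mixing_set F X T A"
proof -
  let ?Trans = "\<lambda>n. transitive_points F (fiber_tuples_topology X p n) (diagonal_map n T)"
  obtain x where x: "x \<in> ?Trans 2" "x \<in> PiE {1..2} (\<lambda>i. UNIV \<inter> A)"
    using dense[of 2 "\<lambda>_. UNIV"] A(2) by auto
  have "\<exists>x\<in>A. \<exists>y\<in>A. x \<noteq> y"
    using transitive_pair_distinct[OF F uv x(1)] x(2) by (force simp: PiE_iff)
  moreover have "(\<Inter>i\<in>{1..k}. hitting_times T (U i \<inter> A) (V i)) \<in> F"
    if k: "k \<ge> 1" and UV: "\<forall>i\<in>{1..k}. openin (top_of_set X) (U i) \<and> U i \<inter> A \<noteq> {} \<and>
                     openin (top_of_set X) (V i) \<and> V i \<inter> A \<noteq> {}"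
    for k :: nat and U V :: "nat \<Rightarrow> 'a set"
  proof -
    have "\<forall>i\<in>{1..k}. \<exists>G. open G \<and> U i = X \<inter> G"
      using UV by (simp add: openin_open)
    then obtain U1 where U1: "\<forall>i\<in>{1..k}. open (U1 i) \<and> U i = X \<inter> U1 i"
      by (rule bchoice[THEN exE])
    have "\<forall>i\<in>{1..k}. \<exists>G. open G \<and> V i = X \<inter> G"
      using UV by (simp add: openin_open)
    then obtain V1 where V1: "\<forall>i\<in>{1..k}. open (V1 i) \<and> V i = X \<inter> V1 i"
      by (rule bchoice[THEN exE])
    \<comment> \<open>an unconstrained extra coordinate, because tuples have length at least two\<close>
    define n where "n = Suc k"
    define U2 V2 where "U2 i = (if i \<le> k then U1 i else UNIV)"
      and "V2 i = (if i \<le> k then V1 i else UNIV)" for i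
    have U2: "open (U2 i) \<and> U2 i \<inter> A \<noteq> {}" if "i \<in> {1..n}" for i
    proof (cases "i \<le> k")
      case True
      then have "open (U1 i)" "U i = X \<inter> U1 i" "U i \<inter> A \<noteq> {}"
        using U1 UV that by auto
      then show ?thesis using True by (auto simp: U2_def)
    qed (use A(2) in \<open>simp add: U2_def\<close>)
    have V2: "open (V2 i) \<and> (\<exists>v. v \<in> V2 i \<inter> A)" if "i \<in> {1..n}" for i
    proof (cases "i \<le> k")
      case True
      then have "open (V1 i)" "V i = X \<inter> V1 i" "V i \<inter> A \<noteq> {}"
        using V1 UV that by auto
      then show ?thesis using True by (auto simp: V2_def)
    qed (use A(2) in \<open>auto simp: V2_def\<close>)
    obtain a where a: "a \<in> ?Trans n" "a \<in> PiE {1..n} (\<lambda>i. U2 i \<inter> A)"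
      using dense[of n U2] U2 k by (auto simp: n_def)
    obtain w where w: "\<And>i. i \<in> {1..n} \<Longrightarrow> w i \<in> V2 i \<inter> A"
      using V2 by metis
    have "restrict w {1..n} \<in> fiber_box X p n V2"
      using w A(3) by (auto simp: fiber_box_def fiber_tuples_def fiber_def PiE_iff subset_iff)
    then have "entering_times (diagonal_map n T) a (fiber_box X p n V2) \<in> F"
      using a(1) V2 openin_fiber_box[of n V2 X p] by (auto simp: transitive_points_def)
    moreover have "entering_times (diagonal_map n T) a (fiber_box X p n V2)
        \<subseteq> (\<Inter>i\<in>{1..k}. hitting_times T (U i \<inter> A) (V i))"
    proof
      fix m assume m: "m \<in> entering_times (diagonal_map n T) a (fiber_box X p n V2)"
      have "a \<in> extensional {1..n}" using a(2) by (auto simp: PiE_iff)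
      with m have m1: "1 \<le> m" and mV: "(\<lambda>i\<in>{1..n}. (T ^^ m) (a i)) \<in> fiber_box X p n V2"
        by (auto simp: entering_times_def diagonal_map_funpow)
      have "m \<in> hitting_times T (U i \<inter> A) (V i)" if i: "i \<in> {1..k}" for i
      proof -
        have i': "i \<in> {1..n}" using i by (auto simp: n_def)
        have "(T ^^ m) (a i) \<in> X" "(T ^^ m) (a i) \<in> V2 i"
          using mV i' by (auto simp: fiber_box_def fiber_tuples_def PiE_iff)
        then have "(T ^^ m) (a i) \<in> V i"
          using i bspec[OF V1 i] by (simp add: V2_def)
        moreover have "a i \<in> U i \<inter> A"
          using PiE_mem[OF a(2) i'] i bspec[OF U1 i] A(3) by (auto simp: U2_def fiber_def)
        ultimately show ?thesis using m1 by (auto simp: hitting_times_def)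
      qed
      then show "m \<in> (\<Inter>i\<in>{1..k}. hitting_times T (U i \<inter> A) (V i))" by blast
    qed
    ultimately show ?thesis
      by (rule furstenberg_family_mono[OF F]) (use k in \<open>auto simp: hitting_times_def\<close>)
  qed
  ultimately show ?thesis
    using A(1) unfolding mixing_set_def by blast
qed

section \<open>Genericity by Baire category\<close>

text \<open>
  The base consists of balls centred at finite nets of mesh tending to \<open>0\<close>. The ambient type need not
  be second countable, hence the base has the base property only at points of \<open>X\<close>.
\<close>

lemma compact_countable_base:
  fixes X :: "'a::metric_space set"
  assumes "compact X"
  obtains \<B> :: "'a set set" where "countable \<B>" "\<And>B. B \<in> \<B> \<Longrightarrow> open B"
    "\<And>x U. x \<in> X \<Longrightarrow> open U \<Longrightarrow> x \<in> U \<Longrightarrow> \<exists>B\<in>\<B>. x \<in> B \<and> B \<subseteq> U"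
proof -
  have "\<exists>K. finite K \<and> X \<subseteq> (\<Union>x\<in>K. ball x (1 / Suc n))" for n
    using assms unfolding compact_eq_totally_bounded by simp
  then obtain K where K: "\<And>n. finite (K n)" "\<And>n. X \<subseteq> (\<Union>x\<in>K n. ball x (1 / Suc n))"
    by metis
  define \<B> where "\<B> = (\<Union>n. (\<lambda>c. ball c (1 / Suc n)) ` K n)"
  show ?thesis
  proof (rule that[of \<B>])
    show "countable \<B>"
      unfolding \<B>_def by (intro countable_UN[OF countableI_type] countable_image countable_finite K(1))
    show "open B" if "B \<in> \<B>" for B
      using that by (auto simp: \<B>_def)
    show "\<exists>B\<in>\<B>. x \<in> B \<and> B \<subseteq> U" if x: "x \<in> X" "open U" "x \<in> U" for x U
    proof -
      obtain e where e: "e > 0" "ball x e \<subseteq> U"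
        using x by (meson openE)
      obtain n where n: "inverse (Suc n) < e / 2"
        using e(1) reals_Archimedean[of "e / 2"] by auto
      obtain c where c: "c \<in> K n" "dist c x < 1 / Suc n"
        using K(2)[of n] x(1) by auto
      have "ball c (1 / Suc n) \<subseteq> ball x e"
      proof
        fix z assume "z \<in> ball c (1 / Suc n)"
        then have "dist x z < 1 / Suc n + 1 / Suc n"
          using c(2) dist_triangle[of x z c] by (simp add: dist_commute)
        then show "z \<in> ball x e"
          using n by (simp add: inverse_eq_divide)
      qed
      then show ?thesis
        using c e(2) by (intro bexI[of _ "ball c (1 / Suc n)"]) (auto simp: \<B>_def)
    qed
  qed
qed

text \<open>
  The finite power of \<open>A\<close> is compact and Hausdorff, hence a Baire space. If each of the open sets
  \<open>W m\<close> is dense in it, which needs testing only on boxes from a countable base, then so is their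
  intersection.
\<close>

lemma gdelta_meets_boxes:
  fixes X :: "'a::metric_space set"
  assumes X: "compact X" and A: "closedin (top_of_set X) A" "A \<subseteq> fiber X p y"
    and W: "\<And>m::nat. openin (fiber_tuples_topology X p n) (W m)"
    and base: "\<And>x U. x \<in> X \<Longrightarrow> open U \<Longrightarrow> x \<in> U \<Longrightarrow> \<exists>B\<in>\<B>. x \<in> B \<and> B \<subseteq> U"
    and meets: "\<And>m B. \<lbrakk>B \<in> {1..n} \<rightarrow>\<^sub>E \<B>; \<And>i. i \<in> {1..n} \<Longrightarrow> B i \<inter> A \<noteq> {}\<rbrakk>
      \<Longrightarrow> W m \<inter> PiE {1..n} (\<lambda>i. B i \<inter> A) \<noteq> {}"
    and U: "\<And>i. i \<in> {1..n} \<Longrightarrow> open (U i) \<and> U i \<inter> A \<noteq> {}"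
  shows "(\<Inter>m. W m) \<inter> PiE {1..n} (\<lambda>i. U i \<inter> A) \<noteq> {}"
proof -
  have AX: "A \<subseteq> X" using A(2) by (auto simp: fiber_def)
  define K where "K = product_topology (\<lambda>_. top_of_set A) {1..n}"
  have topK: "topspace K = PiE {1..n} (\<lambda>_. A)"
    by (simp add: K_def)
  have K_eq: "K = subtopology (fiber_tuples_topology X p n) (PiE {1..n} (\<lambda>_. A))"
  proof -
    have "PiE {1..n} (\<lambda>_. A) \<subseteq> fiber_tuples X p n"
    proof
      fix x assume "x \<in> PiE {1..n} (\<lambda>_. A)"
      then show "x \<in> fiber_tuples X p n"
        using A(2) by (auto simp: fiber_tuples_def fiber_def PiE_iff subset_iff)
    qed
    moreover have "X \<inter> A = A" using AX by blast
    ultimately show ?thesis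
      by (simp add: K_def fiber_tuples_topology_def subtopology_subtopology Int_absorb1
          subtopology_product_topology)
  qed
  have "compact A"
    using closedin_compact[OF X A(1)] .
  then have "compact_space K" "Hausdorff_space K"
    by (auto simp: K_def compact_space_product_topology compact_space_subtopology
        Hausdorff_space_product_topology Hausdorff_space_subtopology)
  then have Baire: "completely_metrizable_space K \<or> locally_compact_space K \<and> regular_space K"
    by (simp add: compact_Hausdorff_imp_regular_space compact_imp_locally_compact_space)
  have openK: "openin K (W m \<inter> PiE {1..n} (\<lambda>_. A))" for m
    unfolding K_eq by (rule openin_subtopology_Int[OF W])
  have closureK: "K closure_of (W m \<inter> PiE {1..n} (\<lambda>_. A)) = topspace K" for m
    unfolding dense_intersects_open
  proof (intro allI impI)
    fix V assume V: "openin K V \<and> V \<noteq> {}"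
    then obtain v where v: "v \<in> V" by blast
    then obtain C where C: "v \<in> PiE {1..n} C" "PiE {1..n} C \<subseteq> V"
      "\<And>i. i \<in> {1..n} \<Longrightarrow> openin (top_of_set A) (C i)"
      using V product_topology_box_neighbourhood[of "\<lambda>_. top_of_set A" "{1..n}" V v] unfolding K_def by blast
    have "\<exists>B\<in>\<B>. v i \<in> B \<and> B \<inter> A \<subseteq> C i" if i: "i \<in> {1..n}" for i
    proof -
      obtain G where "open G" "C i = A \<inter> G"
        using C(3)[OF i] by (auto simp: openin_open)
      moreover have "v i \<in> C i" using C(1) i by (auto simp: PiE_iff)
      ultimately show ?thesis
        using base[of "v i" G] AX by blast
    qed
    then obtain B where B: "\<And>i. i \<in> {1..n} \<Longrightarrow> B i \<in> \<B> \<and> v i \<in> B i \<and> B i \<inter> A \<subseteq> C i"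
      by metis
    have vA: "v i \<in> A" if "i \<in> {1..n}" for i
      using that v V openin_subset[of K V] topK by (auto simp: PiE_iff)
    have "W m \<inter> PiE {1..n} (\<lambda>i. restrict B {1..n} i \<inter> A) \<noteq> {}"
    proof (rule meets)
      show "restrict B {1..n} \<in> {1..n} \<rightarrow>\<^sub>E \<B>"
        using B by (simp add: restrict_PiE_iff)
      show "restrict B {1..n} i \<inter> A \<noteq> {}" if "i \<in> {1..n}" for i
        using B[OF that] vA[OF that] that by (auto simp only: restrict_apply')
    qed
    then obtain a where a: "a \<in> W m" "a \<in> PiE {1..n} (\<lambda>i. restrict B {1..n} i \<inter> A)"
      by blast
    have "a \<in> PiE {1..n} C"
      unfolding PiE_iff
    proof (intro conjI ballI)
      fix i assume i: "i \<in> {1..n}"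
      then show "a i \<in> C i"
        using PiE_mem[OF a(2) i] B[OF i] by auto
    qed (use a(2) in \<open>simp add: PiE_iff\<close>)
    moreover have "a \<in> PiE {1..n} (\<lambda>_. A)"
      using a(2) by (auto simp: PiE_iff)
    ultimately show "W m \<inter> PiE {1..n} (\<lambda>_. A) \<inter> V \<noteq> {}"
      using a(1) C(2) by blast
  qed
  have dense:
    "K closure_of (\<Inter>m. W m \<inter> PiE {1..n} (\<lambda>_. A)) = topspace K"
    by (rule Baire_category[OF Baire]) (use openK closureK in auto)
  have "openin K (PiE {1..n} (\<lambda>i. A \<inter> U i))"
    unfolding K_def using U by (subst openin_PiE) (auto simp: openin_open_Int)
  moreover have "PiE {1..n} (\<lambda>i. A \<inter> U i) \<noteq> {}"
    using U unfolding PiE_eq_empty_iff by blast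
  ultimately have "(\<Inter>m. W m \<inter> PiE {1..n} (\<lambda>_. A)) \<inter> PiE {1..n} (\<lambda>i. A \<inter> U i) \<noteq> {}"
    using dense unfolding dense_intersects_open by blast
  moreover have "PiE {1..n} (\<lambda>i. A \<inter> U i) = PiE {1..n} (\<lambda>i. U i \<inter> A)"
    by (simp only: Int_commute)
  ultimately show ?thesis by auto
qed

text \<open>
  Both claims of the theorem are instances of this lemma: \<open>Z\<close> is a Baire space which parametrises
  closed sets \<open>A z\<close> in fibers in a lower semicontinuous way. Write the transitive \<open>n\<close>-tuples as an
  intersection of open sets \<open>W n m\<close>. The requirement that a transitive tuple of points of \<open>A z\<close> lies
  in a given box is not visibly a \<open>G\<^sub>\<delta>\<close> condition on \<open>z\<close>. The requirement that \<open>W n m\<close> meets every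
  basic box around points of \<open>A z\<close> amounts to countably many conditions, each satisfied on a
  dense open set of parameters; and it suffices, by Baire category on the power of \<open>A z\<close>.
\<close>

lemma residual_mixing_fibers:
  fixes X :: "'a::metric_space set" and Z :: "'c topology"
  assumes X: "compact X" and F: "furstenberg_family F"
    and uv: "u \<in> X" "v \<in> X" "u \<noteq> v" "p u = p v"
    and gdelta: "\<And>n. n \<ge> 2 \<Longrightarrow> gdelta_in (fiber_tuples_topology X p n)
        (transitive_points F (fiber_tuples_topology X p n) (diagonal_map n T))"
    and Z: "completely_metrizable_space Z \<or> locally_compact_space Z \<and> regular_space Z"
    and A: "\<And>z. z \<in> topspace Z \<Longrightarrow>
        closedin (top_of_set X) (A z) \<and> A z \<noteq> {} \<and> (\<exists>y. A z \<subseteq> fiber X p y)"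
    and lower: "\<And>U. open U \<Longrightarrow> openin Z {z \<in> topspace Z. A z \<inter> U \<noteq> {}}"
    and dense: "\<And>n U G z. \<lbrakk>n \<ge> 2; \<And>i. i \<in> {1..n} \<Longrightarrow> open (U i) \<and> A z \<inter> U i \<noteq> {};
        openin Z G; z \<in> G\<rbrakk> \<Longrightarrow> \<exists>z'\<in>G.
          transitive_points F (fiber_tuples_topology X p n) (diagonal_map n T)
            \<inter> PiE {1..n} (\<lambda>i. U i \<inter> A z') \<noteq> {}"
  shows "\<exists>Z0. dense_gdelta_in Z Z0 \<and> (\<forall>z\<in>Z0. mixing_set F X T (A z))"
proof -
  let ?Trans = "\<lambda>n. transitive_points F (fiber_tuples_topology X p n) (diagonal_map n T)"
  obtain \<B> where \<B>: "countable \<B>" "\<And>B. B \<in> \<B> \<Longrightarrow> open B"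
    "\<And>x U. x \<in> X \<Longrightarrow> open U \<Longrightarrow> x \<in> U \<Longrightarrow> \<exists>B\<in>\<B>. x \<in> B \<and> B \<subseteq> U"
    using compact_countable_base[OF X] by blast
  have "\<forall>n\<ge>2. \<exists>W. (\<forall>m::nat. openin (fiber_tuples_topology X p n) (W m)) \<and> \<Inter>(range W) = ?Trans n"
  proof (intro allI impI)
    fix n :: nat assume "n \<ge> 2"
    then obtain C where "\<forall>m::nat. openin (fiber_tuples_topology X p n) (C m)" "\<Inter>(range C) = ?Trans n"
      using gdelta[of n] unfolding gdelta_in_descending by blast
    then show "\<exists>W. (\<forall>m::nat. openin (fiber_tuples_topology X p n) (W m)) \<and> \<Inter>(range W) = ?Trans n"
      by (intro exI[of _ C]) simp
  qed
  then obtain W where W: "\<And>n m. n \<ge> 2 \<Longrightarrow> openin (fiber_tuples_topology X p n) (W n (m::nat))"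
    "\<And>n. n \<ge> 2 \<Longrightarrow> (\<Inter>m. W n m) = ?Trans n"
    by metis
  define C where "C n B = {z \<in> topspace Z. \<forall>i\<in>{1..n}. A z \<inter> B i \<noteq> {}}" for n and B :: "nat \<Rightarrow> 'a set"
  define P where "P n m B = {z \<in> topspace Z. W n m \<inter> PiE {1..n} (\<lambda>i. B i \<inter> A z) \<noteq> {}}" for n m B
  define D where "D n m B = P n m B \<union> (topspace Z - Z closure_of (C n B))" for n m B
  \<comment> \<open>A point of \<open>D n m B\<close> either satisfies the condition attached to the box \<open>B\<close> or lies outside
    \<open>C n B\<close>, where that condition is void. Removing the closure of \<open>C n B\<close>, not just \<open>C n B\<close>, keeps
    \<open>D n m B\<close> open.\<close>
  have openC: "openin Z (C n B)" if "n \<ge> 2" "\<And>i. i \<in> {1..n} \<Longrightarrow> open (B i)" for n B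
  proof -
    have "openin Z (\<Inter>i\<in>{1..n}. {z \<in> topspace Z. A z \<inter> B i \<noteq> {}})"
      using that lower by (intro openin_Inter) auto
    moreover have "(\<Inter>i\<in>{1..n}. {z \<in> topspace Z. A z \<inter> B i \<noteq> {}}) = C n B"
    proof -
      have "1 \<in> {1..n}" using that(1) by simp
      then show ?thesis unfolding C_def by blast
    qed
    ultimately show ?thesis by simp
  qed
  have openP: "openin Z (P n m B)" if n: "n \<ge> 2" and B: "\<And>i. i \<in> {1..n} \<Longrightarrow> open (B i)" for n m B
  proof (subst openin_subopen, intro ballI)
    fix z assume z: "z \<in> P n m B"
    then obtain a where a: "a \<in> W n m" "a \<in> PiE {1..n} (\<lambda>i. B i \<inter> A z)" and zZ: "z \<in> topspace Z"
      by (auto simp: P_def)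
    obtain U where U: "\<And>i. i \<in> {1..n} \<Longrightarrow> open (U i) \<and> a i \<in> U i" "fiber_box X p n U \<subseteq> W n m"
      using fiber_box_neighbourhood[OF W(1)[OF n] a(1)] by blast
    let ?N = "C n (\<lambda>i. U i \<inter> B i)"
    have "openin Z ?N"
      using n B U(1) by (intro openC) auto
    moreover have "z \<in> ?N"
      using zZ U(1) a(2) by (fastforce simp: C_def PiE_iff)
    moreover have "?N \<subseteq> P n m B"
    proof
      fix z' assume z': "z' \<in> ?N"
      then have z'Z: "z' \<in> topspace Z" by (simp add: C_def)
      have "\<forall>i\<in>{1..n}. \<exists>b. b \<in> A z' \<inter> (U i \<inter> B i)"
        using z' by (auto simp: C_def)
      then obtain b where b: "\<And>i. i \<in> {1..n} \<Longrightarrow> b i \<in> A z' \<inter> (U i \<inter> B i)"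
        by metis
      have "restrict b {1..n} \<in> fiber_box X p n U"
        using b A[OF z'Z] by (auto simp: fiber_box_def fiber_tuples_def fiber_def PiE_iff subset_iff)
      moreover have "restrict b {1..n} \<in> PiE {1..n} (\<lambda>i. B i \<inter> A z')"
        using b by auto
      ultimately show "z' \<in> P n m B"
        using z'Z U(2) unfolding P_def by blast
    qed
    ultimately show "\<exists>N. openin Z N \<and> z \<in> N \<and> N \<subseteq> P n m B" by blast
  qed
  have openD: "openin Z (D n m B)" if "n \<ge> 2" "\<And>i. i \<in> {1..n} \<Longrightarrow> open (B i)" for n m B
    unfolding D_def by (intro openin_Un openP openin_diff openin_topspace closedin_closure_of that)
  have denseD: "Z closure_of (D n m B) = topspace Z"
    if n: "n \<ge> 2" and B: "\<And>i. i \<in> {1..n} \<Longrightarrow> open (B i)" for n m B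
    unfolding dense_intersects_open
  proof (intro allI impI)
    fix G assume G: "openin Z G \<and> G \<noteq> {}"
    show "D n m B \<inter> G \<noteq> {}"
    proof (cases "G \<inter> C n B = {}")
      case True
      then have "G \<inter> Z closure_of (C n B) = {}"
        using G by (simp add: openin_Int_closure_of_eq_empty)
      then show ?thesis
        using G openin_subset[of Z G] by (auto simp: D_def)
    next
      case False
      then obtain z where z: "z \<in> G" "z \<in> C n B" by blast
      then obtain z' where z': "z' \<in> G" "?Trans n \<inter> PiE {1..n} (\<lambda>i. B i \<inter> A z') \<noteq> {}"
        using dense[of n B z G] n B G by (auto simp: C_def)
      then have "z' \<in> P n m B"
        using G openin_subset[of Z G] unfolding P_def W(2)[OF n, symmetric] by blast
      then show ?thesis using z'(1) by (auto simp: D_def)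
    qed
  qed
  define I where "I = (SIGMA n:{2::nat..}. (UNIV :: nat set) \<times> ({1..n} \<rightarrow>\<^sub>E \<B>))"
  \<comment> \<open>The whole space is inserted so that the intersection stays inside it.\<close>
  define \<D> where "\<D> = insert (topspace Z) ((\<lambda>(n, m, B). D n m B) ` I)"
  have "countable I"
    using \<B>(1) unfolding I_def by (intro countable_SIGMA countable_PiE countable_SIGMA) auto
  then have cD: "countable \<D>" by (simp add: \<D>_def)
  have oD: "openin Z V \<and> Z closure_of V = topspace Z" if "V \<in> \<D>" for V
    using that openD denseD \<B>(2) by (auto simp: \<D>_def I_def PiE_iff)
  have "Z closure_of \<Inter>\<D> = topspace Z"
    using Z cD oD by (intro Baire_category) auto
  moreover have "gdelta_in Z (\<Inter>\<D>)"
    using cD oD by (intro gdelta_in_Inter open_imp_gdelta_in) (auto simp: \<D>_def)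
  ultimately have "dense_gdelta_in Z (\<Inter>\<D>)"
    by (simp add: dense_gdelta_in_def)
  moreover have "mixing_set F X T (A z)" if z: "z \<in> \<Inter>\<D>" for z
  proof -
    have zZ: "z \<in> topspace Z" using z by (simp add: \<D>_def)
    then obtain y where y: "A z \<subseteq> fiber X p y" using A by blast
    show ?thesis
    proof (rule mixing_set_if_transitive_tuples_dense[OF F uv _ _ y])
      fix n :: nat and U :: "nat \<Rightarrow> 'a set"
      assume n: "2 \<le> n" and U: "\<And>i. i \<in> {1..n} \<Longrightarrow> open (U i) \<and> U i \<inter> A z \<noteq> {}"
      have "(\<Inter>m. W n m) \<inter> PiE {1..n} (\<lambda>i. U i \<inter> A z) \<noteq> {}"
      proof (rule gdelta_meets_boxes[OF X _ y W(1)[OF n] \<B>(3) _ U])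
        fix m B assume B: "B \<in> {1..n} \<rightarrow>\<^sub>E \<B>" and BA: "\<And>i. i \<in> {1..n} \<Longrightarrow> B i \<inter> A z \<noteq> {}"
        have "z \<in> D n m B"
          using z B n by (force simp: \<D>_def I_def)
        moreover have "z \<in> C n B"
          using zZ BA unfolding C_def by blast
        then have "z \<in> Z closure_of (C n B)"
          using openC[OF n, of B] B \<B>(2) closure_of_subset[of "C n B" Z] openin_subset
          by (metis (no_types, lifting) PiE_mem subsetD)
        ultimately show "W n m \<inter> PiE {1..n} (\<lambda>i. B i \<inter> A z) \<noteq> {}"
          by (auto simp: D_def P_def)
      qed (use A[OF zZ] in auto)
      then show "?Trans n \<inter> PiE {1..n} (\<lambda>i. U i \<inter> A z) \<noteq> {}"
        by (simp add: W(2)[OF n])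
    qed (use A[OF zZ] in auto)
  qed
  ultimately show ?thesis by blast
qed

section \<open>The hyperspace of closed sets in fibers\<close>

lemma infdist_less_obtain:
  assumes "A \<noteq> {}" "infdist x A < e"
  obtains a where "a \<in> A" "dist x a < e"
proof -
  have "(INF a\<in>A. dist x a) < e"
    using assms by (simp add: infdist_notempty)
  then show ?thesis
    using assms(1) that by (subst (asm) cINF_less_iff) auto
qed

lemma abs_infdist_diff_le_hausdorff_dist:
  assumes X: "compact X" and A: "A \<in> hyperspace X" and B: "B \<in> hyperspace X"
  shows "\<bar>infdist x A - infdist x B\<bar> \<le> hausdorff_dist A B"
proof -
  have "infdist x D - hausdorff_dist C D \<le> infdist x C"
    if C: "C \<in> hyperspace X" and D: "D \<in> hyperspace X" for C D
  proof -
    have "infdist x D - hausdorff_dist C D \<le> dist x c" if "c \<in> C" for c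
      using infdist_triangle[of x D c] infdist_le_hausdorff_dist[OF X C D that] by simp
    then show ?thesis
      using hyperspaceD(1)[OF X C] by (auto simp: infdist_notempty intro: cINF_greatest)
  qed
  from this[OF A B] this[OF B A] show ?thesis
    by (simp add: hausdorff_dist_commute[of B A])
qed

lemma hausdorff_dist_le:
  assumes X: "compact X" and A: "A \<in> hyperspace X" and B: "B \<in> hyperspace X"
    and "\<And>a. a \<in> A \<Longrightarrow> infdist a B \<le> e" "\<And>b. b \<in> B \<Longrightarrow> infdist b A \<le> e"
  shows "hausdorff_dist A B \<le> e"
proof -
  have "(SUP a\<in>A. infdist a B) \<le> e" "(SUP b\<in>B. infdist b A) \<le> e"
    using assms hyperspaceD(1)[OF X A] hyperspaceD(1)[OF X B] by (auto intro: cSUP_least)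
  then show ?thesis
    using hyperspaceD[OF X A] hyperspaceD[OF X B] by (simp add: hausdorff_dist_def)
qed

lemma fiber_space_iff:
  fixes Y :: "'b::metric_space set"
  assumes p: "continuous_map (top_of_set X) (top_of_set Y) p"
  shows "A \<in> fiber_space X Y p \<longleftrightarrow>
    A \<noteq> {} \<and> closedin (top_of_set X) A \<and> (\<exists>y\<in>Y. A \<subseteq> fiber X p y)"
proof
  assume A: "A \<in> fiber_space X Y p"
  then obtain y where "y \<in> Y" and "closedin (top_of_set (fiber X p y)) A"
    by (auto simp: fiber_space_def hyperspace_def)
  then have "A \<subseteq> fiber X p y"
    using closedin_imp_subset by blast
  moreover have "A \<in> hyperspace X"
    using A fiber_space_subset_hyperspace[OF p] by blast
  ultimately show "A \<noteq> {} \<and> closedin (top_of_set X) A \<and> (\<exists>y\<in>Y. A \<subseteq> fiber X p y)"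
    using \<open>y \<in> Y\<close> unfolding hyperspace_def mem_Collect_eq by (intro conjI bexI[of _ y]) simp_all
next
  assume A: "A \<noteq> {} \<and> closedin (top_of_set X) A \<and> (\<exists>y\<in>Y. A \<subseteq> fiber X p y)"
  then obtain y where y: "y \<in> Y" "A \<subseteq> fiber X p y" by blast
  then have "closedin (top_of_set (fiber X p y)) A"
    using A by (intro closedin_subset_trans[of X A "fiber X p y"]) (simp_all add: fiber_def)
  then show "A \<in> fiber_space X Y p"
    using A y by (auto simp: fiber_space_def hyperspace_def)
qed

text \<open>
  A closed set \<open>A\<close> is determined by its distance function \<open>infdist x A\<close>, and the Hausdorff distance
  bounds the uniform distance of these functions. So along a Cauchy sequence the distance functions
  converge, to \<open>f\<close> say, and the limit set is the zero set of \<open>f\<close>. Compactness of \<open>X\<close> shows that this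
  zero set comes close to every point of a late member of the sequence. It lies in one fiber
  because any two of its points are limits of points from common fibers.
\<close>

lemma mcomplete_fiber_space:
  fixes X :: "'a::metric_space set" and Y :: "'b::metric_space set"
  assumes X: "compact X" and p: "continuous_map (top_of_set X) (top_of_set Y) p"
  shows "Metric_space.mcomplete (fiber_space X Y p) hausdorff_dist"
proof -
  interpret H: Metric_space "hyperspace X" hausdorff_dist
    by (rule Metric_space_hyperspace[OF X])
  interpret FS: Metric_space "fiber_space X Y p" hausdorff_dist
    by (rule H.subspace[OF fiber_space_subset_hyperspace[OF p]])
  have pY: "p x \<in> Y" if "x \<in> X" for x
    using p that by (auto simp: continuous_map_def)
  have "\<exists>A. limitin FS.mtopology \<sigma> A sequentially" if \<sigma>: "FS.MCauchy \<sigma>" for \<sigma>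
  proof -
    have \<sigma>F: "\<sigma> k \<in> fiber_space X Y p" for k
      using \<sigma> by (auto simp: FS.MCauchy_def)
    have \<sigma>H: "\<sigma> k \<in> hyperspace X" for k
      using \<sigma>F fiber_space_subset_hyperspace[OF p] by blast
    have \<sigma>ne: "\<sigma> k \<noteq> {}" and \<sigma>X: "\<sigma> k \<subseteq> X" for k
      using \<sigma>H[of k] closedin_subset[of "top_of_set X" "\<sigma> k"] by (auto simp: hyperspace_def)
    have \<sigma>p: "p a = p b" if "a \<in> \<sigma> k" "b \<in> \<sigma> k" for a b k
      using \<sigma>F[of k] that unfolding fiber_space_iff[OF p] by (auto simp: fiber_def subset_iff)
    have cauchy: "\<exists>N. \<forall>k\<ge>N. \<forall>j\<ge>N. hausdorff_dist (\<sigma> k) (\<sigma> j) < e" if "e > 0" for e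
      using \<sigma> that unfolding FS.MCauchy_def by metis
    have "Cauchy (\<lambda>k. infdist x (\<sigma> k))" for x
    proof (rule CauchyI)
      fix e :: real assume "e > 0"
      then obtain N where N: "\<And>k j. k \<ge> N \<Longrightarrow> j \<ge> N \<Longrightarrow> hausdorff_dist (\<sigma> k) (\<sigma> j) < e"
        using cauchy by blast
      have "norm (infdist x (\<sigma> m) - infdist x (\<sigma> n)) < e" if "m \<ge> N" "n \<ge> N" for m n
        using abs_infdist_diff_le_hausdorff_dist[OF X \<sigma>H \<sigma>H, of x m n] N[OF that] by simp
      then show "\<exists>M. \<forall>m\<ge>M. \<forall>n\<ge>M. norm (infdist x (\<sigma> m) - infdist x (\<sigma> n)) < e"
        by blast
    qed
    then have "\<exists>l. (\<lambda>k. infdist x (\<sigma> k)) \<longlonglongrightarrow> l" for x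
      by (meson Cauchy_convergent convergent_def)
    then obtain f where f: "\<And>x. (\<lambda>k. infdist x (\<sigma> k)) \<longlonglongrightarrow> f x"
      by metis
    define A where "A = {x \<in> X. f x = 0}"
    have f_nonneg: "0 \<le> f x" for x
      by (rule LIMSEQ_le_const[OF f]) (auto simp: infdist_nonneg)
    have "\<bar>f x - f y\<bar> \<le> dist x y" for x y
    proof (rule LIMSEQ_le_const2)
      show "(\<lambda>k. \<bar>infdist x (\<sigma> k) - infdist y (\<sigma> k)\<bar>) \<longlonglongrightarrow> \<bar>f x - f y\<bar>"
        by (intro tendsto_intros f)
      show "\<exists>N. \<forall>n\<ge>N. \<bar>infdist x (\<sigma> n) - infdist y (\<sigma> n)\<bar> \<le> dist x y"
        using infdist_triangle_abs by blast
    qed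
    then have "continuous_on X f"
      unfolding continuous_on_iff dist_real_def by (metis order_le_less_trans)
    then have closedA: "closedin (top_of_set X) A"
      unfolding A_def by (rule continuous_closedin_preimage_constant)
    have near: "\<exists>a\<in>A. dist b a \<le> e"
      if N: "\<And>k j. k \<ge> N \<Longrightarrow> j \<ge> N \<Longrightarrow> hausdorff_dist (\<sigma> k) (\<sigma> j) < e"
        and k: "k \<ge> N" and b: "b \<in> \<sigma> k" for e N k b
    proof -
      \<comment> \<open>A cluster point of the points \<open>c j\<close> of \<open>\<sigma> (j + N)\<close> near \<open>b\<close> is a zero of \<open>f\<close>.\<close>
      have "\<exists>c\<in>\<sigma> (j + N). dist b c < e" for j
      proof -
        have "infdist b (\<sigma> (j + N)) < e"
          using infdist_le_hausdorff_dist[OF X \<sigma>H[of k] \<sigma>H[of "j + N"] b] N[OF k, of "j + N"] by simp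
        then show ?thesis
          using infdist_less_obtain[OF \<sigma>ne] by blast
      qed
      then obtain c where c: "\<And>j. c j \<in> \<sigma> (j + N)" "\<And>j. dist b (c j) < e"
        by metis
      obtain l r where l: "l \<in> X" "strict_mono (r :: nat \<Rightarrow> nat)" "(c \<circ> r) \<longlonglongrightarrow> l"
        using X \<sigma>X c(1) unfolding compact_def by (metis subsetD)
      have dl: "(\<lambda>j. dist z ((c \<circ> r) j)) \<longlonglongrightarrow> dist z l" for z
        by (intro tendsto_intros l(3))
      have "(\<lambda>j. infdist l (\<sigma> (j + N))) \<longlonglongrightarrow> f l"
        using f[of l] by (rule LIMSEQ_ignore_initial_segment)
      then have "(\<lambda>j. infdist l (\<sigma> (r j + N))) \<longlonglongrightarrow> f l"
        using LIMSEQ_subseq_LIMSEQ[OF _ l(2)] by (fastforce simp: o_def)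
      then have "f l \<le> dist l l"
        using dl[of l] by (rule LIMSEQ_le) (use infdist_le[OF c(1)] in \<open>auto simp: o_def\<close>)
      then have "l \<in> A"
        using f_nonneg[of l] l(1) by (simp add: A_def)
      moreover have "dist b l \<le> e"
        using dl[of b] by (rule LIMSEQ_le_const2) (use c(2) less_imp_le in \<open>auto simp: o_def\<close>)
      ultimately show ?thesis by blast
    qed
    have "A \<noteq> {}"
    proof -
      obtain N where N: "\<And>k j. k \<ge> N \<Longrightarrow> j \<ge> N \<Longrightarrow> hausdorff_dist (\<sigma> k) (\<sigma> j) < 1"
        using cauchy[of 1] by auto
      obtain b where "b \<in> \<sigma> N" using \<sigma>ne by blast
      then show ?thesis using near[OF N _ \<open>b \<in> \<sigma> N\<close>] by blast
    qed
    have lim_p: "\<exists>s. (\<forall>k. s k \<in> \<sigma> k) \<and> (\<lambda>k. p (s k)) \<longlonglongrightarrow> p a" if a: "a \<in> A" for a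
    proof -
      have "\<exists>b\<in>\<sigma> k. dist a b < infdist a (\<sigma> k) + 1 / Suc k" for k
        using infdist_less_obtain[OF \<sigma>ne, of a k "infdist a (\<sigma> k) + 1 / Suc k"] by force
      then obtain s where s: "\<And>k. s k \<in> \<sigma> k" "\<And>k. dist a (s k) < infdist a (\<sigma> k) + 1 / Suc k"
        by metis
      have "(\<lambda>k. infdist a (\<sigma> k) + 1 / Suc k) \<longlonglongrightarrow> f a + 0"
        by (intro tendsto_add f LIMSEQ_Suc[OF lim_1_over_n])
      then have lim0: "(\<lambda>k. infdist a (\<sigma> k) + 1 / Suc k) \<longlonglongrightarrow> 0"
        using a by (simp add: A_def)
      have "(\<lambda>k. dist (s k) a) \<longlonglongrightarrow> 0"
      proof (rule tendsto_sandwich[OF _ _ tendsto_const lim0])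
        show "\<forall>\<^sub>F k in sequentially. 0 \<le> dist (s k) a" by simp
        show "\<forall>\<^sub>F k in sequentially. dist (s k) a \<le> infdist a (\<sigma> k) + 1 / Suc k"
          by (rule always_eventually) (use s(2) less_imp_le in \<open>metis dist_commute\<close>)
      qed
      then have "s \<longlonglongrightarrow> a" by (rule tendsto_dist_iff[THEN iffD2])
      moreover have "continuous_on X p" using p by simp
      ultimately have "(\<lambda>k. p (s k)) \<longlonglongrightarrow> p a"
        using a s(1) \<sigma>X unfolding A_def continuous_on_sequentially o_def by blast
      then show ?thesis using s(1) by blast
    qed
    have "p a = p b" if ab: "a \<in> A" "b \<in> A" for a b
    proof -
      obtain s t where "\<And>k. s k \<in> \<sigma> k" "(\<lambda>k. p (s k)) \<longlonglongrightarrow> p a"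
        and "\<And>k. t k \<in> \<sigma> k" "(\<lambda>k. p (t k)) \<longlonglongrightarrow> p b"
        using lim_p ab by metis
      moreover have "(\<lambda>k. p (s k)) = (\<lambda>k. p (t k))"
        using calculation \<sigma>p by blast
      ultimately show ?thesis by (metis LIMSEQ_unique)
    qed
    moreover have AX: "A \<subseteq> X" by (auto simp: A_def)
    moreover obtain a where "a \<in> A" using \<open>A \<noteq> {}\<close> by blast
    ultimately have "A \<subseteq> fiber X p (p a)" "p a \<in> Y"
      using pY unfolding fiber_def by blast+
    then have AF: "A \<in> fiber_space X Y p"
      using \<open>A \<noteq> {}\<close> closedA unfolding fiber_space_iff[OF p] by blast
    then have AH: "A \<in> hyperspace X"
      using fiber_space_subset_hyperspace[OF p] by blast
    have "\<exists>N. \<forall>k\<ge>N. hausdorff_dist (\<sigma> k) A < e" if e: "e > 0" for e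
    proof -
      obtain N where N: "\<And>k j. k \<ge> N \<Longrightarrow> j \<ge> N \<Longrightarrow> hausdorff_dist (\<sigma> k) (\<sigma> j) < e / 2"
        using cauchy[of "e / 2"] e by auto
      have "hausdorff_dist (\<sigma> k) A \<le> e / 2" if k: "k \<ge> N" for k
      proof (rule hausdorff_dist_le[OF X \<sigma>H AH])
        fix b assume "b \<in> \<sigma> k"
        then obtain a where "a \<in> A" "dist b a \<le> e / 2"
          using near[OF N k] by blast
        then show "infdist b A \<le> e / 2" by (rule infdist_le2)
      next
        fix a assume a: "a \<in> A"
        have "infdist a (\<sigma> k) - f a \<le> e / 2"
        proof (rule LIMSEQ_le_const2)
          show "(\<lambda>j. infdist a (\<sigma> k) - infdist a (\<sigma> j)) \<longlonglongrightarrow> infdist a (\<sigma> k) - f a"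
            by (intro tendsto_intros f)
          have "infdist a (\<sigma> k) - infdist a (\<sigma> j) \<le> e / 2" if "j \<ge> N" for j
            using abs_infdist_diff_le_hausdorff_dist[OF X \<sigma>H \<sigma>H, of a k j] N[OF k that] by simp
          then show "\<exists>N. \<forall>n\<ge>N. infdist a (\<sigma> k) - infdist a (\<sigma> n) \<le> e / 2" by blast
        qed
        then show "infdist a (\<sigma> k) \<le> e / 2" using a by (simp add: A_def)
      qed
      then show ?thesis using e by (intro exI[of _ N]) fastforce
    qed
    then have "limitin FS.mtopology \<sigma> A sequentially"
      using AF \<sigma>F by (simp add: FS.limitin_metric eventually_sequentially)
    then show ?thesis by blast
  qed
  then show ?thesis by (simp add: FS.mcomplete_def)
qed

lemma fiber_space_topology_eq_mtopology:
  fixes Y :: "'b::metric_space set"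
  assumes X: "compact X" and p: "continuous_map (top_of_set X) (top_of_set Y) p"
  shows "fiber_space_topology X Y p = Metric_space.mtopology (fiber_space X Y p) hausdorff_dist"
proof -
  interpret Submetric "hyperspace X" hausdorff_dist "fiber_space X Y p"
    by (intro Submetric.intro Metric_space_hyperspace X Submetric_axioms.intro
        fiber_space_subset_hyperspace p)
  show ?thesis by (simp add: fiber_space_topology_def mtopology_submetric)
qed

lemma openin_fiber_space_meets:
  fixes X :: "'a::metric_space set" and Y :: "'b::metric_space set"
  assumes X: "compact X" and p: "continuous_map (top_of_set X) (top_of_set Y) p" and U: "open U"
  shows "openin (fiber_space_topology X Y p) {A \<in> fiber_space X Y p. A \<inter> U \<noteq> {}}"
proof -
  interpret FS: Metric_space "fiber_space X Y p" hausdorff_dist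
    by (rule Metric_space.subspace[OF Metric_space_hyperspace[OF X] fiber_space_subset_hyperspace[OF p]])
  have FH: "A \<in> hyperspace X" if "A \<in> fiber_space X Y p" for A
    using that fiber_space_subset_hyperspace[OF p] by blast
  have "\<exists>r>0. FS.mball A r \<subseteq> {A \<in> fiber_space X Y p. A \<inter> U \<noteq> {}}"
    if A: "A \<in> fiber_space X Y p" and "A \<inter> U \<noteq> {}" for A
  proof -
    obtain a r where a: "a \<in> A" "r > 0" "ball a r \<subseteq> U"
      using \<open>A \<inter> U \<noteq> {}\<close> U by (metis Int_iff all_not_in_conv openE)
    have "B \<inter> U \<noteq> {}" if B: "B \<in> FS.mball A r" for B
    proof -
      have BF: "B \<in> fiber_space X Y p" and "hausdorff_dist A B < r"
        using B by auto
      then have "infdist a B < r"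
        using infdist_le_hausdorff_dist[OF X FH[OF A] FH[OF BF] a(1)] by simp
      then obtain b where "b \<in> B" "dist a b < r"
        using infdist_less_obtain hyperspaceD(1)[OF X FH[OF BF]] by metis
      then show ?thesis using a(3) by auto
    qed
    then show ?thesis using a(2) by (intro exI[of _ r]) auto
  qed
  then show ?thesis
    by (auto simp: fiber_space_topology_eq_mtopology[OF X p] FS.openin_mtopology)
qed

text \<open>
  The witness is a finite set. Take points of \<open>A\<close> in the sets \<open>U i\<close>, append a finite net of \<open>A\<close>, and approximate
  the resulting long tuple by a transitive tuple \<open>x\<close>. Its entries form a set close to \<open>A\<close>, and
  its first \<open>n\<close> entries are again a transitive tuple. Working with the long tuple at once matters:
  a transitive \<open>n\<close>-tuple found first might lie in a fiber that is far from the rest of \<open>A\<close>.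
\<close>

lemma fiber_space_dense_transitive_sets:
  fixes X :: "'a::metric_space set" and Y :: "'b::metric_space set"
  assumes X: "compact X" and p: "continuous_map (top_of_set X) (top_of_set Y) p"
    and F: "furstenberg_family F"
    and mix: "point_mixing_all_orders F X T p"
    and n: "n \<ge> 2" and U: "\<And>i. i \<in> {1..n} \<Longrightarrow> open (U i) \<and> A \<inter> U i \<noteq> {}"
    and G: "openin (fiber_space_topology X Y p) G" "A \<in> G"
  shows "\<exists>B\<in>G. transitive_points F (fiber_tuples_topology X p n) (diagonal_map n T)
            \<inter> PiE {1..n} (\<lambda>i. U i \<inter> B) \<noteq> {}"
proof -
  interpret FS: Metric_space "fiber_space X Y p" hausdorff_dist
    by (rule Metric_space.subspace[OF Metric_space_hyperspace[OF X] fiber_space_subset_hyperspace[OF p]])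
  have FH: "A \<in> hyperspace X" if "A \<in> fiber_space X Y p" for A
    using that fiber_space_subset_hyperspace[OF p] by blast
  obtain e where e: "e > 0" "FS.mball A e \<subseteq> G" and GF: "G \<subseteq> fiber_space X Y p"
    using G by (auto simp: fiber_space_topology_eq_mtopology[OF X p] FS.openin_mtopology)
  then have AF: "A \<in> fiber_space X Y p" using G(2) by blast
  then obtain y where y: "A \<subseteq> fiber X p y" unfolding fiber_space_iff[OF p] by blast
  have "compact A" using hyperspaceD(2)[OF X FH[OF AF]] .
  then obtain K where K: "finite K" "K \<subseteq> A" "A \<subseteq> (\<Union>x\<in>K. ball x (e / 4))"
    using compactE_image[of A A "\<lambda>x. ball x (e / 4)"] e(1) by (metis open_ball UN_I centre_in_ball
      subsetI zero_less_divide_iff zero_less_numeral)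
  obtain xs where xs: "set xs = K" using finite_list[OF K(1)] by blast
  have "\<forall>i\<in>{1..n}. \<exists>c. c \<in> A \<inter> U i" using U by blast
  then obtain c where c: "\<And>i. i \<in> {1..n} \<Longrightarrow> c i \<in> A \<inter> U i" by metis
  define N where "N = n + length xs"
  define w where "w i = (if i \<le> n then c i else xs ! (i - Suc n))" for i
  define V where "V i = ball (w i) (e / 4) \<inter> (if i \<le> n then U i else UNIV)" for i
  have wA: "w i \<in> A" if "i \<in> {1..N}" for i
  proof (cases "i \<le> n")
    case False
    then have "xs ! (i - Suc n) \<in> set xs"
      using that by (intro nth_mem) (auto simp: N_def)
    then show ?thesis using False K(2) xs by (auto simp: w_def)
  qed (use c[of i] that in \<open>simp add: w_def\<close>)
  have V: "open (V i) \<and> w i \<in> V i" if "i \<in> {1..N}" for i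
    using that e(1) U[of i] c[of i] by (auto simp: V_def w_def)
  have "openin (fiber_tuples_topology X p N) (fiber_box X p N V)"
    using V by (intro openin_fiber_box) blast
  moreover have "restrict w {1..N} \<in> fiber_box X p N V"
    using wA V y by (auto simp: fiber_box_def fiber_tuples_def fiber_def PiE_iff subset_iff)
  moreover have "fiber_tuples_topology X p N closure_of
      transitive_points F (fiber_tuples_topology X p N) (diagonal_map N T)
      = topspace (fiber_tuples_topology X p N)"
    using mix n by (simp add: point_mixing_all_orders_def dense_gdelta_in_def N_def)
  ultimately obtain x where x: "x \<in> fiber_box X p N V"
    "x \<in> transitive_points F (fiber_tuples_topology X p N) (diagonal_map N T)"
    unfolding dense_intersects_open by blast
  define B where "B = x ` {1..N}"
  have one: "1 \<in> {1..N}" using n by (simp add: N_def)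
  have xX: "x i \<in> X" and xV: "x i \<in> V i" and xp: "p (x i) = p (x 1)" if "i \<in> {1..N}" for i
    using x(1) that one unfolding fiber_box_def fiber_tuples_def PiE_iff by blast+
  have xw: "dist (w i) (x i) < e / 4" if "i \<in> {1..N}" for i
    using xV[OF that] by (simp add: V_def)
  have BX: "B \<subseteq> X" using xX by (auto simp: B_def)
  have BF: "B \<in> fiber_space X Y p"
    unfolding fiber_space_iff[OF p]
  proof (intro conjI bexI)
    show "B \<noteq> {}" using one by (auto simp: B_def)
    have "closed B" by (simp add: B_def finite_imp_closed)
    then show "closedin (top_of_set X) B" using BX by (rule closed_subset[rotated])
    show "B \<subseteq> fiber X p (p (x 1))"
    proof
      fix b assume "b \<in> B"
      then obtain i where "i \<in> {1..N}" "b = x i" unfolding B_def by blast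
      then show "b \<in> fiber X p (p (x 1))"
        using xX[of i] xp[of i] unfolding fiber_def by blast
    qed
    show "p (x 1) \<in> Y" using p xX[OF one] by (auto simp: continuous_map_def)
  qed
  have "hausdorff_dist A B \<le> e / 2"
  proof (rule hausdorff_dist_le[OF X FH[OF AF] FH[OF BF]])
    fix a assume "a \<in> A"
    then obtain j where j: "j < length xs" "dist (xs ! j) a < e / 4"
      using K(3) xs by (fastforce simp: in_set_conv_nth)
    define i where "i = Suc n + j"
    have i: "i \<in> {1..N}" "w i = xs ! j" using j(1) by (auto simp: i_def N_def w_def)
    have "dist a (x i) \<le> e / 2"
      using xw[OF i(1)] j(2) dist_triangle[of a "x i" "xs ! j"] i(2) by (simp add: dist_commute)
    moreover have "x i \<in> B" using i(1) by (simp add: B_def)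
    ultimately show "infdist a B \<le> e / 2" by (metis infdist_le2)
  next
    fix b assume "b \<in> B"
    then obtain i where i: "i \<in> {1..N}" "b = x i" by (auto simp: B_def)
    have "dist b (w i) \<le> e / 2"
      using xw[OF i(1)] i(2) e(1) by (simp add: dist_commute)
    then show "infdist b A \<le> e / 2" using wA[OF i(1)] by (metis infdist_le2)
  qed
  then have "B \<in> G" using e AF BF by (intro subsetD[OF e(2)]) auto
  moreover have "restrict x {1..n} \<in> transitive_points F (fiber_tuples_topology X p n) (diagonal_map n T)"
    using transitive_points_restrict[OF F _ _ x(2)] n by (simp add: N_def)
  moreover have "restrict x {1..n} \<in> PiE {1..n} (\<lambda>i. U i \<inter> B)"
  proof (unfold restrict_PiE_iff, intro ballI)
    fix i assume i: "i \<in> {1..n}"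
    then have "i \<in> {1..N}" by (simp add: N_def)
    then show "x i \<in> U i \<inter> B" using xV[of i] i by (auto simp: V_def B_def)
  qed
  ultimately show ?thesis by blast
qed

section \<open>Generic sets and generic fibers are mixing\<close>

theorem theorem5p5:
  fixes X :: "'a::metric_space set" and T :: "'a \<Rightarrow> 'a"
    and Y :: "'b::metric_space set" and S :: "'b \<Rightarrow> 'b"
    and p :: "'a \<Rightarrow> 'b" and F :: "nat set set"
  assumes "dynamical_system X T" and "dynamical_system Y S"
    and "intrinsic_factor_map X T Y S p"
    and "furstenberg_family F"
    and "point_mixing_all_orders F X T p"
  shows "residual_in (fiber_space_topology X Y p) {A. mixing_set F X T A} \<and>
    (open_map (top_of_set X) (top_of_set Y) p \<longrightarrow>
      (\<exists>Y0. dense_gdelta_in (top_of_set Y) Y0 \<and>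
        (\<forall>y\<in>Y0. mixing_set F X T (fiber X p y))))"
proof (intro conjI impI)
  let ?Trans = "\<lambda>n. transitive_points F (fiber_tuples_topology X p n) (diagonal_map n T)"
  have X: "compact X" and Y: "compact Y"
    using assms(1,2) by (auto simp: dynamical_system_def)
  have p: "continuous_map (top_of_set X) (top_of_set Y) p" and pX: "p ` X = Y"
    using assms(3) by (auto simp: intrinsic_factor_map_def factor_map_def)
  obtain u v where uv: "u \<in> X" "v \<in> X" "u \<noteq> v" "p u = p v"
    using intrinsic_factor_map_not_inj[OF X assms(3)] by blast
  have gdelta: "gdelta_in (fiber_tuples_topology X p n) (?Trans n)"
    and denseT: "fiber_tuples_topology X p n closure_of ?Trans n = topspace (fiber_tuples_topology X p n)"
    if "n \<ge> 2" for n
    using assms(5) that by (auto simp: point_mixing_all_orders_def dense_gdelta_in_def)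
  note residual = residual_mixing_fibers[where p = p, OF X assms(4) uv gdelta]

  let ?H = "fiber_space_topology X Y p"
  have topH: "topspace ?H = fiber_space X Y p"
    by (rule topspace_fiber_space_topology[OF X p])
  have "\<exists>Z0. dense_gdelta_in ?H Z0 \<and> (\<forall>A\<in>Z0. mixing_set F X T A)"
  proof (rule residual)
    show "completely_metrizable_space ?H \<or> locally_compact_space ?H \<and> regular_space ?H"
      using Metric_space.completely_metrizable_space_mtopology[OF
          Metric_space.subspace[OF Metric_space_hyperspace[OF X] fiber_space_subset_hyperspace[OF p]]
          mcomplete_fiber_space[OF X p]]
      by (simp add: fiber_space_topology_eq_mtopology[OF X p])
    show "closedin (top_of_set X) A \<and> A \<noteq> {} \<and> (\<exists>y. A \<subseteq> fiber X p y)" if "A \<in> topspace ?H" for A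
      using that unfolding topH fiber_space_iff[OF p] by blast
    show "openin ?H {A \<in> topspace ?H. A \<inter> U \<noteq> {}}" if "open U" for U
      unfolding topH by (rule openin_fiber_space_meets[OF X p that])
  qed (assumption | rule fiber_space_dense_transitive_sets[OF X p assms(4,5)])+
  then obtain Z0 where Z0: "dense_gdelta_in ?H Z0" "\<forall>A\<in>Z0. mixing_set F X T A"
    by blast
  moreover have "Z0 \<subseteq> topspace ?H"
    using Z0(1) gdelta_in_subset unfolding dense_gdelta_in_def by blast
  ultimately show "residual_in ?H {A. mixing_set F X T A}"
    unfolding residual_in_def by blast

  assume op: "open_map (top_of_set X) (top_of_set Y) p"
  show "\<exists>Y0. dense_gdelta_in (top_of_set Y) Y0 \<and> (\<forall>y\<in>Y0. mixing_set F X T (fiber X p y))"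
  proof (rule residual)
    show "completely_metrizable_space (top_of_set Y) \<or>
        locally_compact_space (top_of_set Y) \<and> regular_space (top_of_set Y)"
      using Y by (auto simp: compact_space_subtopology Hausdorff_space_subtopology
          intro!: compact_imp_locally_compact_space compact_Hausdorff_imp_regular_space)
    show "closedin (top_of_set X) (fiber X p y) \<and> fiber X p y \<noteq> {} \<and> (\<exists>y'. fiber X p y \<subseteq> fiber X p y')"
      if "y \<in> topspace (top_of_set Y)" for y
      using closedin_continuous_map_preimage[OF p, of "{y}"] that pX
      by (auto simp: fiber_def closed_subset)
    show "openin (top_of_set Y) {y \<in> topspace (top_of_set Y). fiber X p y \<inter> U \<noteq> {}}" if "open U" for U
    proof -
      have "{y \<in> topspace (top_of_set Y). fiber X p y \<inter> U \<noteq> {}} = p ` (X \<inter> U)"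
      proof (intro equalityI subsetI)
        fix y assume "y \<in> {y \<in> topspace (top_of_set Y). fiber X p y \<inter> U \<noteq> {}}"
        then obtain x where "x \<in> X" "p x = y" "x \<in> U" by (auto simp: fiber_def)
        then show "y \<in> p ` (X \<inter> U)" by blast
      next
        fix y assume "y \<in> p ` (X \<inter> U)"
        then obtain x where "x \<in> X" "p x = y" "x \<in> U" by blast
        then show "y \<in> {y \<in> topspace (top_of_set Y). fiber X p y \<inter> U \<noteq> {}}"
          using pX by (auto simp: fiber_def)
      qed
      then show ?thesis
        using op that by (simp add: open_map_def openin_open_Int)
    qed
    fix n :: nat and U :: "nat \<Rightarrow> 'a set" and G y
    assume n: "n \<ge> 2" and U: "\<And>i. i \<in> {1..n} \<Longrightarrow> open (U i) \<and> fiber X p y \<inter> U i \<noteq> {}"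
      and G: "openin (top_of_set Y) G" "y \<in> G"
    \<comment> \<open>A transitive tuple near a tuple in the fiber of \<open>y\<close> lies in a fiber over a point near \<open>y\<close>.\<close>
    obtain G' where G': "open G'" "{x \<in> X. p x \<in> G} = X \<inter> G'"
      using openin_continuous_map_preimage[OF p G(1)] by (auto simp: openin_open)
    have "\<forall>i\<in>{1..n}. \<exists>c. c \<in> fiber X p y \<inter> U i" using U by blast
    then obtain c where c: "\<And>i. i \<in> {1..n} \<Longrightarrow> c i \<in> fiber X p y \<inter> U i" by metis
    have cG: "c i \<in> G'" if "i \<in> {1..n}" for i
      using c[OF that] G(2) G'(2) by (auto simp: fiber_def)
    have "openin (fiber_tuples_topology X p n) (fiber_box X p n (\<lambda>i. U i \<inter> G'))"
      using U G'(1) by (intro openin_fiber_box) auto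
    moreover have "restrict c {1..n} \<in> fiber_box X p n (\<lambda>i. U i \<inter> G')"
      using c cG by (auto simp: fiber_box_def fiber_tuples_def fiber_def PiE_iff)
    ultimately obtain a where a: "a \<in> ?Trans n" "a \<in> fiber_box X p n (\<lambda>i. U i \<inter> G')"
      using denseT[OF n] unfolding dense_intersects_open by blast
    have one: "1 \<in> {1..n}" using n by simp
    have aX: "a i \<in> X" and aU: "a i \<in> U i" and aG: "a i \<in> G'" and ap: "p (a i) = p (a 1)"
      if "i \<in> {1..n}" for i
      using a(2) that one unfolding fiber_box_def fiber_tuples_def PiE_iff by blast+
    have ext: "a \<in> extensional {1..n}"
      using a(2) fiber_tuples_extensional unfolding fiber_box_def by blast
    have "p (a 1) \<in> G"
      using aX[OF one] aG[OF one] G'(2) by auto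
    moreover have "a \<in> PiE {1..n} (\<lambda>i. U i \<inter> fiber X p (p (a 1)))"
      unfolding PiE_iff fiber_def using aX aU ap ext by blast
    ultimately have "?Trans n \<inter> PiE {1..n} (\<lambda>i. U i \<inter> fiber X p (p (a 1))) \<noteq> {}" "p (a 1) \<in> G"
      using a(1) by blast+
    then show "\<exists>z'\<in>G. ?Trans n \<inter> PiE {1..n} (\<lambda>i. U i \<inter> fiber X p z') \<noteq> {}"
      by (rule bexI)
  qed
qed

end
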